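(* We have $N_1=N_2=N_3=1$.
   Context: Let $\mathbb{N}=\{0,1,2,\ldots\}$ and $\mathbb{N}^*=\mathbb{N}\setminus\{0\}$. For $\delta\in(0,1/2]$ and $k\in\mathbb{N}$ put $\mathcal{K}_k(\delta)=[k+\delta,k+1-\delta]$, and let $\mathcal{K}(\delta)=\bigcup_{k\in\mathbb{N}}\mathcal{K}_k(\delta)$, $\mathcal{K}_{\llbracket 0,N-1\rrbracket}(\delta)=\bigcup_{k=0}^{N-1}\mathcal{K}_k(\delta)$ for $N\in\mathbb{N}^*$. For an integer $d\ge 1$, $\mathcal{K}^d(\delta)=\bigcup_{k\in\mathbb{N}^d}\left(k+[\delta,1-\delta]^d\right)\subset\mathbb{R}^d$. For $A\subset\mathbb{R}^d$ and $B\subset(0,\infty)$, $A/B=\{(a_1/b,\ldots,a_d/b) : (a_1,\ldots,a_d)\in A,\ b\in B\}$. For every integer $d\geq 1$ set $\delta_d=1/(d+2)$. For every integer $d\ge 1$, $N_d$ denotes the least integer $N\geq 1$ such that $[1,\infty)^d\subset \mathcal{K}^d(\delta_d)/\mathcal{K}_{\llbracket 0,N-1\rrbracket}(\delta_d)$, with the convention that $N_d=\infty$ if no $N\in\mathbb{N}^*$ satisfies this inclusion and $[1,\infty)^d\subset\mathcal{K}^d(\delta_d)/\mathcal{K}(\delta_d)$. *)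

theory Defs
  imports Complex_Main "HOL-Library.FuncSet" "HOL-Library.Extended_Nat"
begin

text \<open>
  The dimension \<open>d\<close> is a natural number; points of \<open>\<real>\<^sup>d\<close> are the functions in
  \<open>{..<d} \<rightarrow>\<^sub>E UNIV\<close>, and \<open>S\<^sup>d\<close> is \<open>{..<d} \<rightarrow>\<^sub>E S\<close>.
\<close>

definition cpow :: "'a set \<Rightarrow> nat \<Rightarrow> (nat \<Rightarrow> 'a) set" where
  "cpow S d = {..<d} \<rightarrow>\<^sub>E S"

definition Kint :: "nat \<Rightarrow> real \<Rightarrow> real set" where
  "Kint k \<delta> = {real k + \<delta> .. real k + 1 - \<delta>}"

definition K :: "real \<Rightarrow> real set" where
  "K \<delta> = (\<Union>k. Kint k \<delta>)"

definition K_upto :: "nat \<Rightarrow> real \<Rightarrow> real set" where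
  "K_upto N \<delta> = (\<Union>k\<in>{0..<N}. Kint k \<delta>)"

definition Kd :: "nat \<Rightarrow> real \<Rightarrow> (nat \<Rightarrow> real) set" where
  "Kd d \<delta> = (\<Union>k\<in>cpow (UNIV :: nat set) d.
     (\<lambda>t. \<lambda>i\<in>{..<d}. real (k i) + t i) ` cpow {\<delta>..1 - \<delta>} d)"

definition quot :: "nat \<Rightarrow> (nat \<Rightarrow> real) set \<Rightarrow> real set \<Rightarrow> (nat \<Rightarrow> real) set" where
  "quot d A B = {\<lambda>i\<in>{..<d}. a i / b | a b. a \<in> A \<and> b \<in> B}"

definition delta :: "nat \<Rightarrow> real" where
  "delta d = 1 / (real d + 2)"

definition covers :: "nat \<Rightarrow> real set \<Rightarrow> bool" where
  "covers d B \<longleftrightarrow> cpow {1..} d \<subseteq> quot d (Kd d (delta d)) B"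

text \<open>
  The value is left unspecified when even \<open>K (delta d)\<close> does not suffice, so that
  \<open>Nmin d = \<infinity>\<close> is asserted only under the condition attached to that convention.
\<close>

definition Nmin :: "nat \<Rightarrow> enat" where
  "Nmin d =
     (if \<exists>N\<ge>1. covers d (K_upto N (delta d))
      then enat (LEAST N. N \<ge> 1 \<and> covers d (K_upto N (delta d)))
      else if covers d (K (delta d)) then \<infinity>
      else undefined)"

end

theory Submission
  imports Defs
begin

text \<open>
  Put \<open>n = d + 2\<close> and rescale time by \<open>s = n t\<close>. The claim for \<open>d\<close> becomes: for all speeds
  \<open>v\<^sub>1, \<dots>, v\<^sub>d \<ge> 1\<close> there is a moment \<open>s \<in> [1, n - 1]\<close> at which no phase \<open>s v\<^sub>i\<close> lies within
  distance less than \<open>1\<close> of a multiple of \<open>n\<close>; the speed is then called clear at \<open>s\<close>. A speed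
  \<open>v\<close> alternates between clear intervals of length \<open>(n - 2) / v\<close> and blocked ones of length
  \<open>2 / v\<close>, so every interval of length at least \<open>2 / v\<close> contains a moment at which \<open>v\<close> is clear
  (\<open>clear_in_long_interval\<close>). This settles \<open>d = 1\<close>: the interval \<open>[1, 2]\<close> is long enough if
  \<open>v \<ge> 2\<close>, and \<open>s = 1\<close> works if \<open>v \<le> 2\<close>. For \<open>d = 2\<close> and speeds \<open>x \<le> y\<close>, a full
  clear interval of \<open>x\<close> has length \<open>2 / x \<ge> 2 / y\<close>; one of them fits into \<open>[1, 3]\<close> unless \<open>x\<close> is
  small, and then a few explicit moments remain.

  For \<open>d = 3\<close> order the speeds as \<open>x \<le> y \<le> z\<close>. It suffices to find an interval of length
  \<open>2 / y \<ge> 2 / z\<close> on which both \<open>x\<close> and \<open>y\<close> are clear. Look at the clear intervals of \<open>y\<close>, each of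
  length \<open>3 / y\<close>. The blocked intervals of \<open>x\<close> are at least as long as \<open>2 / y\<close>, and the position of
  the \<open>k\<close>-th clear interval of \<open>y\<close> relative to them advances with \<open>k\<close> like a rotation of the circle
  with step \<open>x / y\<close>, or \<open>1 - x / y\<close> in the opposite direction. The positions that leave enough room form an arc at least as long as the shorter step,
  so the rotation cannot jump over it; it only needs enough time to arrive. For \<open>y \<ge> 7\<close> it has the
  time, except when the lead \<open>y - x\<close> is close to \<open>1\<close> (\<open>three_if_y_twice_x\<close>,
  \<open>three_if_above_strip\<close>, \<open>three_not_clear_imp_strip\<close>): then \<open>y\<close> gains on \<open>x\<close> only three phase
  units, less than a lap, during the whole of \<open>[1, 4]\<close>.

  In this strip \<open>z\<close> has to be taken into account. If \<open>y > 17\<close>, there is an interval near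
  \<open>s = 1\<close> on which \<open>x\<close> and \<open>y\<close> are clear, and \<open>z\<close> can be blocked throughout it only if
  \<open>z - x\<close> is close to \<open>3\<close>. In that case one waits until \<open>z\<close> has gained a whole lap on \<open>x\<close>, which
  happens before \<open>y\<close> has gained three units (\<open>three_in_strip_above_17\<close>).

  What is left are the triples with \<open>y \<le> 7\<close> and two pieces of the strip. For very large
  \<open>z\<close> a few intervals of fixed length suffice; the remaining region is bounded. There the problem is
  one of linear arithmetic: a moment of the form \<open>N / v\<close>, where \<open>N\<close> is an integer and \<open>v\<close> one of
  the speeds \<open>1, x, y, z\<close>, is good on a polyhedron, and finitely many such polyhedra cover the
  region. There is no slack in general: for the speeds \<open>2, 3, 4\<close> only the moments
  \<open>1, 2, 3, 4\<close> are good.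
\<close>

section \<open>Clear moments\<close>

definition clear :: "nat \<Rightarrow> real \<Rightarrow> real \<Rightarrow> bool" where
  "clear n s v \<longleftrightarrow> (\<exists>p::nat. real n * real p + 1 \<le> s * v \<and> s * v \<le> real n * real p + (real n - 1))"

definition jointly_clear :: "nat \<Rightarrow> real set \<Rightarrow> bool" where
  "jointly_clear n V \<longleftrightarrow> (\<exists>s. 1 \<le> s \<and> s \<le> real n - 1 \<and> (\<forall>v\<in>V. clear n s v))"

lemma clearI:
  "real n * real p + 1 \<le> s * v \<Longrightarrow> s * v \<le> real n * real p + (real n - 1) \<Longrightarrow> clear n s v"
  unfolding clear_def by blast

lemma jointly_clearI:
  "1 \<le> s \<Longrightarrow> s \<le> real n - 1 \<Longrightarrow> (\<And>v. v \<in> V \<Longrightarrow> clear n s v) \<Longrightarrow> jointly_clear n V"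
  unfolding jointly_clear_def by blast

lemma previous_multiple:
  fixes r m :: real
  assumes "0 \<le> r" "0 < m"
  obtains k :: nat where "m * real k \<le> r" "r < m * real k + m"
proof -
  define k where "k = nat \<lfloor>r / m\<rfloor>"
  have "0 \<le> r / m" using assms by simp
  then have "real k \<le> r / m" "r / m < real k + 1" unfolding k_def by linarith+
  then have "m * real k \<le> r" "r < m * real k + m" using assms by (simp_all add: field_simps)
  then show thesis by (rule that)
qed

lemma next_multiple:
  fixes r m :: real
  assumes "0 \<le> r" "0 < m"
  obtains k :: nat where "r \<le> m * real k" "m * real k < r + m"
proof -
  obtain k :: nat where k: "m * real k \<le> r" "r < m * real k + m"
    using previous_multiple assms by blast
  show thesis
  proof (cases "m * real k = r")
    case True then show thesis using that[of k] assms by simp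
  next
    case False then show thesis using that[of "Suc k"] k by (simp add: algebra_simps)
  qed
qed

text \<open>
  A discrete intermediate value argument: at the first index satisfying \<open>P\<close>, either the index is the
  left end or its predecessor violates \<open>P\<close>, which bounds the quantity in question from the other side.
\<close>

lemma least_between:
  fixes A B :: nat
  assumes "A \<le> B" "P B"
  obtains k where "A \<le> k" "k \<le> B" "P k" "k = A \<or> (\<exists>l. k = Suc l \<and> \<not> P l)"
proof -
  define k where "k = (LEAST k. A \<le> k \<and> P k)"
  have k: "A \<le> k \<and> P k" unfolding k_def by (rule LeastI[of _ B]) (use assms in simp)
  have "k \<le> B" unfolding k_def by (rule Least_le) (use assms in simp)
  moreover have "k = A \<or> (\<exists>l. k = Suc l \<and> \<not> P l)"
  proof (cases "k = A")
    case False
    then obtain l where l: "k = Suc l" "A \<le> l" using k by (cases k) auto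
    then have "\<not> (A \<le> l \<and> P l)" unfolding k_def by (intro not_less_Least) simp
    then show ?thesis using l by blast
  qed simp
  ultimately show thesis using that k by blast
qed

text \<open>
  If \<open>v\<close> is blocked at \<open>u\<close>, then its phase reaches the end \<open>n p + 1\<close> of that blocked band after
  at most two units, hence not later than \<open>w\<close>.
\<close>

lemma clear_in_long_interval:
  fixes u v w :: real
  assumes n: "2 \<le> n" and "0 \<le> u" "0 < v" and len: "2 \<le> v * (w - u)"
  obtains s where "u \<le> s" "s \<le> w" "clear n s v"
proof -
  obtain p :: nat where p: "real n * real p \<le> u * v + 1" "u * v + 1 < real n * real p + real n"
    using previous_multiple[of "u * v + 1" "real n"] assms by auto
  have "u \<le> w"
    using len \<open>0 < v\<close> by (smt (verit) mult_nonneg_nonpos)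
  show thesis
  proof (cases "real n * real p + 1 \<le> u * v")
    case True
    then have "clear n u v" using p by (intro clearI[of n p]) auto
    then show thesis using that \<open>u \<le> w\<close> by blast
  next
    case False
    define s where "s = (real n * real p + 1) / v"
    have sv: "s * v = real n * real p + 1" using \<open>0 < v\<close> by (simp add: s_def)
    have "u * v \<le> s * v" using False sv by linarith
    moreover have "s * v \<le> w * v" using p(1) len sv by (simp add: algebra_simps)
    ultimately have "u \<le> s" "s \<le> w" using \<open>0 < v\<close> by simp_all
    moreover have "clear n s v" using sv n by (intro clearI[of n p]) auto
    ultimately show thesis using that by blast
  qed
qed

text \<open>
  A moment \<open>s\<close> good for the speeds \<open>x i\<close> yields the divisor \<open>b = s / (d + 2)\<close>, which lies in the
  very first interval \<open>[\<delta>, 1 - \<delta>]\<close>, and \<open>b x\<close> lies in the union of cubes.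
\<close>

lemma Nmin_eq_1:
  assumes "\<And>x :: nat \<Rightarrow> real. (\<And>i. i < d \<Longrightarrow> 1 \<le> x i) \<Longrightarrow> jointly_clear (d + 2) (x ` {..<d})"
  shows "Nmin d = 1"
proof -
  let ?\<delta> = "delta d"
  have del: "?\<delta> * (real d + 2) = 1" by (simp add: delta_def)
  have "covers d (K_upto 1 ?\<delta>)"
    unfolding covers_def
  proof
    fix x :: "nat \<Rightarrow> real" assume x: "x \<in> cpow {1..} d"
    then have "\<And>i. i < d \<Longrightarrow> 1 \<le> x i" by (auto simp: cpow_def PiE_iff)
    then have "jointly_clear (d + 2) (x ` {..<d})" by (rule assms)
    then obtain s where s: "1 \<le> s" "s \<le> real d + 1"
      and cl: "\<forall>i<d. clear (d + 2) s (x i)"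
      by (auto simp: jointly_clear_def)
    from cl have "\<forall>i. \<exists>p. i < d \<longrightarrow> real (d + 2) * real p + 1 \<le> s * x i
                 \<and> s * x i \<le> real (d + 2) * real p + (real (d + 2) - 1)"
      unfolding clear_def by blast
    then obtain p where p: "\<And>i. i < d \<Longrightarrow> real (d + 2) * real (p i) + 1 \<le> s * x i"
      "\<And>i. i < d \<Longrightarrow> s * x i \<le> real (d + 2) * real (p i) + (real (d + 2) - 1)"
      by metis
    define b where "b = s * ?\<delta>"
    have b0: "0 < b" using s by (simp add: b_def delta_def)
    have bK: "b \<in> K_upto 1 ?\<delta>"
      using s by (simp add: b_def K_upto_def Kint_def delta_def divide_simps)
    define a where "a = (\<lambda>i\<in>{..<d}. b * x i)"
    have "a \<in> Kd d ?\<delta>"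
    proof -
      define k where "k = (\<lambda>i\<in>{..<d}. p i)"
      define t where "t = (\<lambda>i\<in>{..<d}. b * x i - real (p i))"
      have "k \<in> cpow UNIV d" by (simp add: k_def cpow_def)
      moreover have "t \<in> cpow {?\<delta>..1 - ?\<delta>} d"
      proof -
        have "t i \<in> {?\<delta>..1 - ?\<delta>}" if "i < d" for i
        proof -
          have "t i = (s * x i - real (d + 2) * real (p i)) / (real d + 2)"
            using that by (simp add: t_def b_def delta_def field_simps)
          then show ?thesis
            using p[OF that] unfolding delta_def by (simp add: divide_simps)
        qed
        then show ?thesis by (auto simp: cpow_def t_def)
      qed
      moreover have "a = (\<lambda>i\<in>{..<d}. real (k i) + t i)"
        by (auto simp: a_def k_def t_def)
      ultimately show ?thesis unfolding Kd_def by blast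
    qed
    moreover have "x = (\<lambda>i\<in>{..<d}. a i / b)"
      using x b0 by (auto simp: a_def cpow_def PiE_iff extensional_def fun_eq_iff)
    ultimately show "x \<in> quot d (Kd d ?\<delta>) (K_upto 1 ?\<delta>)"
      unfolding quot_def using bK by blast
  qed
  then have "(LEAST N. N \<ge> 1 \<and> covers d (K_upto N ?\<delta>)) = 1"
    by (intro Least_equality) auto
  then show ?thesis
    unfolding Nmin_def using \<open>covers d (K_upto 1 ?\<delta>)\<close> by (auto simp: one_enat_def)
qed

section \<open>One and two speeds\<close>

lemma jointly_clear_one:
  fixes x :: real
  assumes "1 \<le> x"
  shows "jointly_clear 3 {x}"
proof (cases "x \<le> 2")
  case True
  then have "clear 3 1 x" using assms by (intro clearI[of 3 0]) auto
  then show ?thesis by (intro jointly_clearI[of 1]) auto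
next
  case False
  then obtain s where "1 \<le> s" "s \<le> 2" "clear 3 s x"
    using clear_in_long_interval[of 3 1 x 2] by auto
  then show ?thesis by (intro jointly_clearI[of s]) auto
qed

text \<open>
  Multiplying by \<open>v\<close> turns the conditions for the moment \<open>N / v\<close> into inequalities that are linear
  in the speeds as long as \<open>N\<close> is a numeral. The negative form makes each moment that is
  tried an additional fact in a proof by contradiction, so that linear arithmetic can decide whether
  a list of moments exhausts all cases.
\<close>

lemma not_jointly_clear_at_ratio:
  fixes v N :: real
  assumes "\<not> jointly_clear n V"
  shows "\<not> (0 < v \<and> v \<le> N \<and> N \<le> (real n - 1) * v
    \<and> (\<forall>w\<in>V. \<exists>p::nat. (real n * real p + 1) * v \<le> N * w \<and> N * w \<le> (real n * real p + (real n - 1)) * v))"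
proof
  assume *: "0 < v \<and> v \<le> N \<and> N \<le> (real n - 1) * v
    \<and> (\<forall>w\<in>V. \<exists>p::nat. (real n * real p + 1) * v \<le> N * w \<and> N * w \<le> (real n * real p + (real n - 1)) * v)"
  have "jointly_clear n V"
  proof (rule jointly_clearI[of "N / v"])
    show "1 \<le> N / v" "N / v \<le> real n - 1" using * by (simp_all add: field_simps)
    fix w assume "w \<in> V"
    with * obtain p :: nat where "(real n * real p + 1) * v \<le> N * w"
      "N * w \<le> (real n * real p + (real n - 1)) * v" by blast
    then show "clear n (N / v) w" using * by (intro clearI[of n p]) (simp_all add: pos_le_divide_eq pos_divide_le_eq)
  qed
  with assms show False by blast
qed

lemma two_not_clear_at_ratio:
  fixes x y v N :: real and p q :: nat
  assumes "\<not> jointly_clear 4 {x, y}"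
  shows "\<not> (0 < v \<and> v \<le> N \<and> N \<le> 3 * v
    \<and> (4 * real p + 1) * v \<le> N * x \<and> N * x \<le> (4 * real p + 3) * v
    \<and> (4 * real q + 1) * v \<le> N * y \<and> N * y \<le> (4 * real q + 3) * v)"
  using not_jointly_clear_at_ratio[OF assms, of v N] by auto

lemma jointly_clear_two:
  fixes x y :: real
  assumes "1 \<le> x" "x \<le> y"
  shows "jointly_clear 4 {x, y}"
proof (rule ccontr)
  assume no: "\<not> jointly_clear 4 {x, y}"
  have catch: False if s: "1 \<le> s0" "s1 \<le> 3" "2 \<le> y * (s1 - s0)"
    and p: "4 * real p + 1 \<le> s0 * x" "s1 * x \<le> 4 * real p + 3" for s0 s1 :: real and p :: nat
  proof -
    from s assms obtain s where *: "s0 \<le> s" "s \<le> s1" "clear 4 s y"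
      using clear_in_long_interval[of 4 s0 y s1] by auto
    have "s0 * x \<le> s * x" "s * x \<le> s1 * x" using * assms by (simp_all add: mult_right_mono)
    then have "clear 4 s x" using p by (intro clearI[of 4 p]) auto
    with * s no show False using jointly_clearI[of s 4 "{x, y}"] by auto
  qed
  \<comment> \<open>For larger \<open>x\<close> a complete clear interval \<open>[4 k + 1, 4 k + 3] / x\<close> fits into \<open>[1, 3]\<close>.\<close>
  have "x < 7 / 3"
  proof (rule ccontr)
    assume x: "\<not> x < 7 / 3"
    obtain k :: nat where k: "x \<le> 4 * real k + 1" "4 * real k + 3 \<le> 3 * x"
    proof (cases "x \<le> 5")
      case True then show ?thesis using that[of 1] x by simp
    next
      case False
      obtain k :: nat where "x - 1 \<le> 4 * real k" "4 * real k < x - 1 + 4"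
        by (rule next_multiple[of "x - 1" 4]) (use False in auto)
      then show ?thesis using that[of k] False by linarith
    qed
    show False
    proof (rule catch[of "(4 * real k + 1) / x" "(4 * real k + 3) / x" k])
      show "1 \<le> (4 * real k + 1) / x" "(4 * real k + 3) / x \<le> 3"
        using k assms by (simp_all add: field_simps)
      have "y * ((4 * real k + 3) / x - (4 * real k + 1) / x) = 2 * (y / x)"
        by (simp add: diff_divide_distrib[symmetric])
      then show "2 \<le> y * ((4 * real k + 3) / x - (4 * real k + 1) / x)"
        using assms by (simp add: field_simps)
    qed (use assms in auto)
  qed
  \<comment> \<open>Since \<open>x < 7 / 3\<close>, it stays clear from \<open>1\<close> to \<open>9 / 7\<close>, which is long enough for \<open>y \<ge> 7\<close>.\<close>
  moreover have "y < 7"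
  proof (rule ccontr)
    assume "\<not> y < 7"
    then have "7 * (2 / 7) \<le> y * (2 / 7)" by simp
    then show False using catch[of 1 "9 / 7" 0] \<open>x < 7 / 3\<close> assms by simp
  qed
  ultimately show False
    using assms two_not_clear_at_ratio[OF no, of 1 1 0 0] two_not_clear_at_ratio[OF no, of 1 1 0 1]
      two_not_clear_at_ratio[OF no, of x 5 1 1] two_not_clear_at_ratio[OF no, of y 9 1 2] two_not_clear_at_ratio[OF no, of y 5 0 1]
    by simp
qed

section \<open>Three speeds: leaving room for the fastest runner\<close>

lemma three_not_clear_at_ratio:
  fixes x y z v N :: real and p q r :: nat
  assumes "\<not> jointly_clear 5 {x, y, z}"
  shows "\<not> (0 < v \<and> v \<le> N \<and> N \<le> 4 * v
    \<and> (5 * real p + 1) * v \<le> N * x \<and> N * x \<le> (5 * real p + 4) * v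
    \<and> (5 * real q + 1) * v \<le> N * y \<and> N * y \<le> (5 * real q + 4) * v
    \<and> (5 * real r + 1) * v \<le> N * z \<and> N * z \<le> (5 * real r + 4) * v)"
  using not_jointly_clear_at_ratio[OF assms, of v N] by auto

lemma three_by_interval:
  fixes x y z s0 s1 :: real and p q :: nat
  assumes "1 \<le> x" "x \<le> y" "y \<le> z"
    and s: "1 \<le> s0" "s1 \<le> 4" "2 \<le> z * (s1 - s0)"
    and p: "5 * real p + 1 \<le> s0 * x" "s1 * x \<le> 5 * real p + 4"
    and q: "5 * real q + 1 \<le> s0 * y" "s1 * y \<le> 5 * real q + 4"
  shows "jointly_clear 5 {x, y, z}"
proof -
  from assms obtain s where *: "s0 \<le> s" "s \<le> s1" "clear 5 s z"
    using clear_in_long_interval[of 5 s0 z s1] by auto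
  have "s0 * x \<le> s * x" "s * x \<le> s1 * x" "s0 * y \<le> s * y" "s * y \<le> s1 * y"
    using * assms by (simp_all add: mult_right_mono)
  then have "clear 5 s x" "clear 5 s y"
    using p q by (auto intro: clearI[of 5 p] clearI[of 5 q])
  with * s show ?thesis by (intro jointly_clearI[of s]) auto
qed

text \<open>
  The \<open>k\<close>-th clear interval of \<open>y\<close> has length \<open>3 / y\<close>, so to leave \<open>2 / y\<close> a blocked interval of
  \<open>x\<close> may cut off at most \<open>1 / y\<close> at one end. The last two hypotheses say that the \<open>j\<close>-th
  clear interval of \<open>x\<close> starts at most \<open>1 / y\<close> after it and ends at most \<open>1 / y\<close> before it.
\<close>

lemma three_by_overlap:
  fixes x y z :: real and j k :: nat
  assumes o: "1 \<le> x" "x \<le> y" "y \<le> z"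
    and k: "y \<le> 5 * real k + 1" "5 * real k + 4 \<le> 4 * y"
    and j: "(5 * real j + 1) * y \<le> (5 * real k + 2) * x" "(5 * real k + 3) * x \<le> (5 * real j + 4) * y"
  shows "jointly_clear 5 {x, y, z}"
proof -
  have pos: "0 < x" "0 < y" using o by auto
  define s0 where "s0 = max ((5 * real k + 1) / y) ((5 * real j + 1) / x)"
  define s1 where "s1 = min ((5 * real k + 4) / y) ((5 * real j + 4) / x)"
  have "2 / y \<le> (5 * real k + 4) / y - (5 * real k + 1) / y"
    using pos by (simp add: diff_divide_distrib[symmetric] divide_right_mono)
  moreover have "2 / y \<le> (5 * real j + 4) / x - (5 * real j + 1) / x"
    using o pos frac_le[of 3 2 x y] by (simp add: diff_divide_distrib[symmetric] frac_le)
  moreover have "2 / y \<le> (5 * real k + 4) / y - (5 * real j + 1) / x"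
  proof -
    have "(5 * real j + 1) / x \<le> (5 * real k + 2) / y"
      using j(1) pos by (simp add: pos_divide_le_eq pos_le_divide_eq)
    then show ?thesis using pos by (simp add: diff_divide_distrib add_divide_distrib)
  qed
  moreover have "2 / y \<le> (5 * real j + 4) / x - (5 * real k + 1) / y"
  proof -
    have "(5 * real k + 3) / y \<le> (5 * real j + 4) / x"
      using j(2) pos by (simp add: pos_divide_le_eq pos_le_divide_eq)
    then show ?thesis using pos by (simp add: diff_divide_distrib add_divide_distrib)
  qed
  ultimately have "2 / y \<le> s1 - s0" unfolding s0_def s1_def by (auto simp: min_def max_def)
  then have "z * (2 / y) \<le> z * (s1 - s0)" using o by (intro mult_left_mono) auto
  moreover have "2 \<le> z * (2 / y)" using o pos by (simp add: field_simps)
  ultimately have "2 \<le> z * (s1 - s0)" by linarith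
  moreover have "1 \<le> (5 * real k + 1) / y" "(5 * real k + 4) / y \<le> 4"
    using k pos by (simp_all add: field_simps)
  then have "1 \<le> s0" "s1 \<le> 4" unfolding s0_def s1_def by auto
  moreover have "5 * real j + 1 \<le> s0 * x" "5 * real k + 1 \<le> s0 * y"
    using pos by (simp_all add: s0_def flip: pos_divide_le_eq)
  moreover have "s1 * x \<le> 5 * real j + 4" "s1 * y \<le> 5 * real k + 4"
    using pos by (simp_all add: s1_def flip: pos_le_divide_eq)
  ultimately show ?thesis using o by (intro three_by_interval[of x y z s0 s1 j k]) auto
qed

text \<open>
  A clear interval of \<open>y\<close> that has already begun at time \<open>1\<close> can still be used if at most
  \<open>1 / y\<close> of it has passed. With \<open>x\<close> and \<open>y\<close> on the same lap, this handles every small lead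
  \<open>y - x\<close>.
\<close>

lemma three_by_overlap_at_start:
  fixes x y z :: real and k :: nat
  assumes o: "1 \<le> x" "x \<le> y" "y \<le> z"
    and k: "y \<le> 5 * real k + 2" "5 * real k + 4 \<le> 4 * y"
    and j: "(5 * real k + 1) * y \<le> (5 * real k + 2) * x"
  shows "jointly_clear 5 {x, y, z}"
proof -
  have pos: "0 < x" "0 < y" using o by auto
  define s0 where "s0 = max 1 ((5 * real k + 1) / x)"
  define s1 where "s1 = (5 * real k + 4) / y"
  have "1 \<le> (5 * real k + 2) / y" "(5 * real k + 1) / x \<le> (5 * real k + 2) / y"
    using k j pos by (simp_all add: pos_divide_le_eq pos_le_divide_eq)
  then have "s0 \<le> (5 * real k + 2) / y" unfolding s0_def by simp
  moreover have "s1 = (5 * real k + 2) / y + 2 / y"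
    by (simp add: s1_def add_divide_distrib[symmetric])
  ultimately have "2 / y \<le> s1 - s0" by simp
  then have "z * (2 / y) \<le> z * (s1 - s0)" using o by (intro mult_left_mono) auto
  moreover have "2 \<le> z * (2 / y)" using o pos by (simp add: field_simps)
  ultimately have "2 \<le> z * (s1 - s0)" by linarith
  moreover have "1 \<le> s0" "s1 \<le> 4" using k pos by (simp_all add: s0_def s1_def field_simps)
  moreover have s0x: "5 * real k + 1 \<le> s0 * x"
    using pos by (simp add: s0_def flip: pos_divide_le_eq)
  moreover have "5 * real k + 1 \<le> s0 * y"
    using s0x o \<open>1 \<le> s0\<close> by (smt (verit) mult_left_mono)
  moreover have s1y: "s1 * y \<le> 5 * real k + 4" using pos by (simp add: s1_def)
  moreover have "s1 * x \<le> 5 * real k + 4"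
  proof -
    have "0 \<le> s1" using pos by (simp add: s1_def)
    then have "s1 * x \<le> s1 * y" using o by (intro mult_left_mono)
    then show ?thesis using s1y by linarith
  qed
  ultimately show ?thesis using o by (intro three_by_interval[of x y z s0 s1 k k]) auto
qed

section \<open>Three speeds: pairs outside a strip\<close>

text \<open>
  Rotation with step \<open>x / y \<le> 1 / 2\<close>. The indices \<open>A\<close> and \<open>B\<close> are the first and the last clear
  interval of \<open>y\<close> within \<open>[1, 4]\<close>. The lap \<open>j\<close> is the first one of \<open>x\<close> whose clear interval is not
  yet over at \<open>A\<close>, and \<open>k\<close> is the first index from \<open>A\<close> on for which it has begun; because a step is
  at most \<open>1 / 2\<close>, it is not over then. That \<open>k \<le> B\<close> is where \<open>y \<ge> 7\<close> enters.
\<close>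

lemma three_if_y_twice_x:
  fixes x y z :: real
  assumes o: "1 \<le> x" "x \<le> y" "y \<le> z" and y: "7 \<le> y" and twice: "2 * x \<le> y"
  shows "jointly_clear 5 {x, y, z}"
proof -
  obtain A :: nat where A: "y - 1 \<le> 5 * real A" "5 * real A < y - 1 + 5"
    by (rule next_multiple[of "y - 1" 5]) (use y in auto)
  obtain B :: nat where B: "5 * real B \<le> 4 * y - 4" "4 * y - 4 < 5 * real B + 5"
    by (rule previous_multiple[of "4 * y - 4" 5]) (use y in auto)
  have "(5 * real A + 3) * x \<le> (5 * real A + 4) * y" using o by (intro mult_mono) auto
  then obtain j where j: "(5 * real A + 3) * x \<le> (5 * real j + 4) * y"
    and j_least: "j = 0 \<or> (\<exists>h. j = Suc h \<and> \<not> (5 * real A + 3) * x \<le> (5 * real h + 4) * y)"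
    using least_between[of 0 A "\<lambda>j. (5 * real A + 3) * x \<le> (5 * real j + 4) * y"] by auto
  have B_above: "(5 * real j + 1) * y \<le> (5 * real B + 2) * x"
  proof (cases "j = 0")
    case True
    have "y * 1 \<le> (5 * real B + 2) * x" using o y B by (intro mult_mono) auto
    then show ?thesis using True by simp
  next
    case False
    then obtain h where Suc: "j = Suc h" and "\<not> (5 * real A + 3) * x \<le> (5 * real h + 4) * y"
      using j_least by auto
    then have gt: "(5 * real j - 1) * y < (5 * real A + 3) * x" using Suc by (simp add: algebra_simps)
    \<comment> \<open>As \<open>j > 0\<close>, the speed \<open>x\<close> is not too small, and then the time from \<open>A\<close> to \<open>B\<close> is long
      enough for a blocked interval of \<open>x\<close> to pass.\<close>
    have "3 * y \<le> (5 * real j - 1) * y - y" if "1 \<le> j"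
      using that y by (simp add: algebra_simps)
    then have "4 * y \<le> (5 * real j - 1) * y" using Suc by simp
    moreover have "(5 * real A + 3) * x \<le> (y + 7) * x" using A o by (intro mult_right_mono) auto
    ultimately have "4 * y < (y + 7) * x" using gt by linarith
    then have "4 * y * (3 * y - 14) \<le> (y + 7) * x * (3 * y - 14)"
      using y by (intro mult_right_mono) auto
    moreover have "(y + 7) * (2 * y) \<le> 4 * y * (3 * y - 14)"
      using mult_nonneg_nonneg[of y "y - 7"] y by (simp add: algebra_simps)
    ultimately have "(y + 7) * (2 * y) \<le> (y + 7) * (x * (3 * y - 14))" by (simp only: mult.assoc)
    then have "2 * y \<le> x * (3 * y - 14)" using y by (simp add: mult_le_cancel_left)
    also have "\<dots> \<le> x * (5 * real B - 5 * real A - 1)" using A B o by (intro mult_left_mono) auto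
    finally show ?thesis using gt by (simp add: algebra_simps)
  qed
  have "A \<le> B" using A B y by linarith
  then obtain k where k: "A \<le> k" "k \<le> B" "(5 * real j + 1) * y \<le> (5 * real k + 2) * x"
    and k_least: "k = A \<or> (\<exists>l. k = Suc l \<and> \<not> (5 * real j + 1) * y \<le> (5 * real l + 2) * x)"
    using least_between[of A B "\<lambda>k. (5 * real j + 1) * y \<le> (5 * real k + 2) * x"] B_above by blast
  have "(5 * real k + 3) * x \<le> (5 * real j + 4) * y"
    using k_least
  proof
    assume "\<exists>l. k = Suc l \<and> \<not> (5 * real j + 1) * y \<le> (5 * real l + 2) * x"
    then obtain l where "k = Suc l" "(5 * real l + 2) * x < (5 * real j + 1) * y" by auto
    then show ?thesis using twice by (simp add: algebra_simps)
  qed (use j in simp)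
  moreover have "real A \<le> real k" "real k \<le> real B" using k by simp_all
  ultimately show ?thesis
    using k A B by (intro three_by_overlap[OF o, of k j]) auto
qed

text \<open>
  For \<open>x \<ge> y / 2\<close> the rotation is best read backwards, as the lead of \<open>y\<close> over \<open>x\<close>, which grows by
  \<open>5 a / y \<le> 5 / 2\<close> from one clear interval of \<open>y\<close> to the next. In terms of \<open>i = k - j\<close>, the number of
  laps by which \<open>y\<close> is ahead, the conditions of \<open>three_by_overlap\<close> say that this lead is within
  about one unit of the full \<open>i\<close> laps. Here \<open>i\<close> is the first number of laps not yet exceeded
  at the beginning, and \<open>k\<close> the first index at which the lead has come close to it.
\<close>

lemma three_if_above_strip:
  fixes x y z :: real
  assumes o: "1 \<le> x" "x \<le> y" "y \<le> z" and y: "7 \<le> y" and twice: "y \<le> 2 * x"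
    and strip: "2 * y \<le> (y - x) * (2 * y - 3)"
  shows "jointly_clear 5 {x, y, z}"
proof -
  define a where "a = y - x"
  have a: "0 \<le> a" "2 * a \<le> y" "4 * y \<le> a * (4 * y - 6)"
    using o twice strip by (simp_all add: a_def algebra_simps)
  obtain A :: nat where A: "y - 1 \<le> 5 * real A" "5 * real A < y - 1 + 5"
    by (rule next_multiple[of "y - 1" 5]) (use y in auto)
  obtain B :: nat where B: "5 * real B \<le> 4 * y - 4" "4 * y - 4 < 5 * real B + 5"
    by (rule previous_multiple[of "4 * y - 4" 5]) (use y in auto)
  have "a * (5 * real A + 2) \<le> (5 * real A + 1) * y"
  proof -
    have "2 * a * (5 * real A + 2) \<le> y * (5 * real A + 2)" using a by (intro mult_right_mono) auto
    moreover have "y * (5 * real A + 2) \<le> y * (10 * real A + 2)" using y by (intro mult_left_mono) auto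
    ultimately show ?thesis by (simp add: algebra_simps)
  qed
  then obtain i where i: "a * (5 * real A + 2) \<le> (5 * real i + 1) * y" and "i \<le> A"
    and i_least: "i = 0 \<or> (\<exists>h. i = Suc h \<and> \<not> a * (5 * real A + 2) \<le> (5 * real h + 1) * y)"
    using least_between[of 0 A "\<lambda>i. a * (5 * real A + 2) \<le> (5 * real i + 1) * y"] by blast
  have B_above: "(5 * real i - 1) * y \<le> a * (5 * real B + 3)"
  proof (cases "i = 0")
    case True
    have "0 \<le> a * (5 * real B + 3)" using a by simp
    then show ?thesis using True o by simp
  next
    case False
    then obtain h where Suc: "i = Suc h" and gt: "(5 * real h + 1) * y < a * (5 * real A + 2)"
      using i_least by auto
    \<comment> \<open>For \<open>i = 1\<close> the lead has to reach nearly one lap by the end, which is the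
      hypothesis on \<open>y - x\<close>. For \<open>i \<ge> 2\<close> the lead is already large at the beginning, so it grows fast.\<close>
    show ?thesis
    proof (cases h)
      case 0
      have "a * (4 * y - 6) \<le> a * (5 * real B + 3)" using a B by (intro mult_left_mono) auto
      then show ?thesis using a 0 Suc by simp
    next
      case (Suc g)
      have "6 * y \<le> (5 * real h + 1) * y" using Suc y by simp
      moreover have "a * (5 * real A + 2) \<le> a * (y + 6)" using a A by (intro mult_left_mono) auto
      ultimately have "6 * y \<le> a * (y + 6)" using gt by linarith
      then have step: "6 * y * (3 * y - 12) \<le> a * (y + 6) * (3 * y - 12)"
        using y by (intro mult_right_mono) auto
      have "(y + 6) * (3 * y) \<le> 6 * y * (3 * y - 12)"
        using mult_nonneg_nonneg[of y "y - 7"] y by (simp add: algebra_simps)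
      also note step
      also have "a * (y + 6) * (3 * y - 12) = (y + 6) * (a * (3 * y - 12))" by simp
      finally have "(y + 6) * (3 * y) \<le> (y + 6) * (a * (3 * y - 12))" .
      then have "3 * y \<le> a * (3 * y - 12)" using y by (simp add: mult_le_cancel_left)
      also have "\<dots> \<le> a * (5 * real B - 5 * real A + 1)" using A B a by (intro mult_left_mono) auto
      finally show ?thesis using gt \<open>i = Suc h\<close> by (simp add: algebra_simps)
    qed
  qed
  have "A \<le> B" using A B y by linarith
  then obtain k where k: "A \<le> k" "k \<le> B" "(5 * real i - 1) * y \<le> a * (5 * real k + 3)"
    and k_least: "k = A \<or> (\<exists>l. k = Suc l \<and> \<not> (5 * real i - 1) * y \<le> a * (5 * real l + 3))"
    using least_between[of A B "\<lambda>k. (5 * real i - 1) * y \<le> a * (5 * real k + 3)"] B_above by blast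
  have k2: "a * (5 * real k + 2) \<le> (5 * real i + 1) * y"
    using k_least
  proof
    assume "\<exists>l. k = Suc l \<and> \<not> (5 * real i - 1) * y \<le> a * (5 * real l + 3)"
    then obtain l where "k = Suc l" "a * (5 * real l + 3) < (5 * real i - 1) * y" by auto
    then show ?thesis using a by (simp add: algebra_simps)
  qed (use i in simp)
  have "real A \<le> real k" "real k \<le> real B" using k by simp_all
  moreover have "real (k - i) = real k - real i" using \<open>i \<le> A\<close> k(1) by simp
  moreover have x: "x = y - a" by (simp add: a_def)
  have "(5 * (real k - real i) + 1) * y \<le> (5 * real k + 2) * x"
    "(5 * real k + 3) * x \<le> (5 * (real k - real i) + 4) * y"
    using k(3) k2 unfolding x by (simp_all add: algebra_simps)
  ultimately show ?thesis
    using A B by (intro three_by_overlap[OF o, of k "k - i"]) auto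
qed

section \<open>Three speeds: the strip\<close>

text \<open>
  The two inequalities confine the lead \<open>a = y - x\<close>: with \<open>M = 5 k + 1\<close> they read
  \<open>x / M < a < 2 y / (2 y - 3)\<close>, and \<open>M\<close> differs from \<open>y\<close> by at most \<open>4\<close>.
\<close>

lemma three_not_clear_imp_strip:
  fixes x y z :: real
  assumes o: "1 \<le> x" "x \<le> y" "y \<le> z" and y: "7 \<le> y" and no: "\<not> jointly_clear 5 {x, y, z}"
  obtains k :: nat where "5 * real k - 3 < y" "y \<le> 5 * real k + 2"
    "(5 * real k + 2) * x < (5 * real k + 1) * y" "(y - x) * (2 * y - 3) < 2 * y"
proof -
  obtain k :: nat where k: "y - 2 \<le> 5 * real k" "5 * real k < y - 2 + 5"
    by (rule next_multiple[of "y - 2" 5]) (use y in auto)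
  have "(y - x) * (2 * y - 3) < 2 * y"
  proof (cases "2 * x \<le> y")
    case True
    then show ?thesis using three_if_y_twice_x[OF o y] no by blast
  next
    case False
    then show ?thesis using three_if_above_strip[OF o y] no by force
  qed
  moreover have "(5 * real k + 2) * x < (5 * real k + 1) * y"
    using three_by_overlap_at_start[OF o, of k] no k y by force
  ultimately show thesis using that[of k] k by auto
qed

text \<open>
  On \<open>[M / x, (M + 3) / y]\<close> both \<open>x\<close> and \<open>y\<close> are clear, being on the same lap \<open>k\<close>. If \<open>z\<close> is
  blocked during this time, its lead \<open>c\<close> over \<open>x\<close> is about \<open>3\<close>, which is squeezed from both ends of
  the interval. At the later moments \<open>(M + 5 i) / x\<close> the speed \<open>x\<close> is clear again, and when for the
  first time the lead of \<open>z\<close> is at least one lap, it is between \<open>5\<close> and \<open>8\<close> units while that of \<open>y\<close>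
  is at most \<open>3\<close>: all three are clear. The bound \<open>17\<close> is what the estimates for \<open>z\<close> require.
\<close>

lemma three_in_strip_above_17:
  fixes x y z :: real and k :: nat
  assumes o: "1 \<le> x" "x \<le> y" "y \<le> z" and y: "17 < y"
    and k: "5 * real k - 3 < y" "y \<le> 5 * real k + 2"
    and low: "(5 * real k + 2) * x < (5 * real k + 1) * y"
    and high: "(y - x) * (2 * y - 3) < 2 * y"
  shows "jointly_clear 5 {x, y, z}"
proof (rule ccontr)
  assume no: "\<not> jointly_clear 5 {x, y, z}"
  define M where "M = 5 * real k + 1"
  define a where "a = y - x"
  define c where "c = z - x"
  have M: "M - 4 < y" "y \<le> M + 1" using k by (simp_all add: M_def)
  have x_eq: "x = y - a" by (simp add: a_def)
  have "16 < M" using M y by linarith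
  then have "3 < k" unfolding M_def by linarith
  then have M21: "21 \<le> M" unfolding M_def by linarith
  have a0: "0 \<le> a" using o by (simp add: a_def)
  have low': "x < a * M" using low by (simp add: M_def a_def algebra_simps)
  have high': "a * (2 * y - 3) < 2 * y" using high by (simp add: a_def)
  have a_small: "10 * a < 11"
  proof (rule ccontr)
    assume "\<not> 10 * a < 11"
    then have "11 / 10 * (2 * y - 3) \<le> a * (2 * y - 3)" using y by (intro mult_right_mono) auto
    also note high'
    finally show False using y by simp
  qed
  \<comment> \<open>So the interval starts after time \<open>1\<close>.\<close>
  have "x < M"
  proof (rule ccontr)
    assume "\<not> x < M"
    moreover from this have "a \<le> 1" using M by (simp add: a_def)
    then have "a * M \<le> 1 * M" using M21 by (intro mult_right_mono) auto
    ultimately show False using low' by simp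
  qed
  \<comment> \<open>Up to time \<open>(5 M + 15) / (3 x)\<close>, the lead of \<open>y\<close> is at most \<open>3\<close>.\<close>
  have a9: "a * (5 * M + 24) \<le> 9 * y"
  proof -
    have "a * (5 * M + 24) \<le> a * (9 / 2 * (2 * y - 3))" using M y a0 by (intro mult_left_mono) auto
    also have "\<dots> = 9 / 2 * (a * (2 * y - 3))" by simp
    also have "\<dots> \<le> 9 / 2 * (2 * y)" using high' by (intro mult_left_mono) auto
    finally show ?thesis by simp
  qed
  \<comment> \<open>The interval has length \<open>(3 x - M a) / (x y)\<close>; this bound says that it is at least \<open>2 / z\<close> when
    \<open>z = x (M + 8) / M\<close>.\<close>
  have room: "2 * M * y \<le> (M + 8) * (3 * x - M * a)"
  proof -
    have "2 * ((M + 8) * (M + 3)) \<le> (2 * y - 3) * (M + 24)"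
    proof -
      have "(2 * M - 11) * (M + 24) \<le> (2 * y - 3) * (M + 24)"
        using M M21 by (intro mult_right_mono) auto
      then show ?thesis using M21 by (simp add: algebra_simps)
    qed
    then have "a * (2 * ((M + 8) * (M + 3))) \<le> a * ((2 * y - 3) * (M + 24))"
      using a0 by (rule mult_left_mono)
    also have "\<dots> = (a * (2 * y - 3)) * (M + 24)" by simp
    also have "\<dots> \<le> (2 * y) * (M + 24)" using high' M21 by (intro mult_right_mono) auto
    finally have "a * ((M + 8) * (M + 3)) \<le> y * (M + 24)" by simp
    then show ?thesis unfolding x_eq by (simp add: algebra_simps)
  qed
  have "0 < (M + 8) * (3 * x - M * a)"
    using room M21 y mult_pos_pos[of "2 * M" y] by linarith
  then have Ma: "M * a < 3 * x" using M21 by (simp add: zero_less_mult_iff)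
  have near: "z * M < x * (M + 8)"
  proof (rule ccontr)
    assume "\<not> z * M < x * (M + 8)"
    then have "x * (M + 8) \<le> z * M" by simp
    then have "x * (M + 8) * (3 * x - M * a) \<le> z * M * (3 * x - M * a)"
      using Ma by (intro mult_right_mono) auto
    moreover have "x * (2 * M * y) \<le> x * ((M + 8) * (3 * x - M * a))"
      using room o by (intro mult_left_mono) auto
    ultimately have "M * (2 * x * y) \<le> M * (z * (3 * x - M * a))" by (simp add: mult.commute mult.left_commute)
    then have *: "2 * x * y \<le> z * (3 * x - M * a)" using M21 by simp
    have "jointly_clear 5 {x, y, z}"
    proof (rule three_by_interval[OF o, of "M / x" "(M + 3) / y" k k])
      show "1 \<le> M / x" using \<open>x < M\<close> o by simp
      show "(M + 3) / y \<le> 4" using M y by (simp add: field_simps)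
      have "(M + 3) / y - M / x = (3 * x - M * a) / (x * y)"
        using o by (simp add: a_def field_simps)
      then show "2 \<le> z * ((M + 3) / y - M / x)"
        using * o by (simp add: pos_le_divide_eq)
      show "5 * real k + 1 \<le> M / x * x" using o by (simp add: M_def)
      show "(M + 3) / y * y \<le> 5 * real k + 4" using o by (simp add: M_def)
      have "M / x * x \<le> M / x * y" using o M21 by (intro mult_left_mono) auto
      then show "5 * real k + 1 \<le> M / x * y" using o by (simp add: M_def)
      have "(M + 3) / y * x \<le> (M + 3) / y * y" using o M21 by (intro mult_left_mono) auto
      then show "(M + 3) / y * x \<le> 5 * real k + 4" using o by (simp add: M_def)
    qed
    then show False using no by blast
  qed
  have p: "5 * real (Suc k) = M + 4" "5 * real k = M - 1" by (simp_all add: M_def)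
  \<comment> \<open>At \<open>M / x\<close> the phase of \<open>z\<close> lies below \<open>M + 8\<close>, so \<open>z\<close> is blocked there only in the band from
    \<open>M + 3\<close> to \<open>M + 5\<close>.\<close>
  have A: "x * (M + 3) < z * M" "z * M < x * (M + 5)"
  proof -
    have "M * x \<le> M * y" "M * y \<le> M * z" using o M21 by simp_all
    moreover have "M * y \<le> (M + 3) * x" using Ma by (simp add: a_def algebra_simps)
    moreover have "M \<le> 4 * x" using M a_small M21 by (simp add: a_def)
    ultimately show "x * (M + 3) < z * M" "z * M < x * (M + 5)"
      using three_not_clear_at_ratio[OF no, of x M k k k] three_not_clear_at_ratio[OF no, of x M k k "Suc k"] \<open>x < M\<close> o near
      unfolding p by (auto simp: algebra_simps)
  qed
  \<comment> \<open>At \<open>(M + 3) / y\<close> it must still be in the same band, since it cannot have crossed the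
    following clear one.\<close>
  have B: "z * (M + 3) < y * (M + 5)"
  proof (rule ccontr)
    assume "\<not> z * (M + 3) < y * (M + 5)"
    moreover have "z * (M + 3) \<le> y * (M + 8)"
    proof -
      have "M * (z * (M + 3)) \<le> x * (M + 5) * (M + 3)"
        using A M21 mult_right_mono[of "z * M" "x * (M + 5)" "M + 3"] by (simp add: mult.commute mult.left_commute)
      also have "\<dots> \<le> x * ((M + 1) * (M + 8))"
        unfolding mult.assoc using M21 o by (intro mult_left_mono) (auto simp: algebra_simps)
      also have "\<dots> \<le> M * y * (M + 8)"
      proof -
        have "x * (M + 1) \<le> M * y" using low' by (simp add: a_def algebra_simps)
        then have "x * (M + 1) * (M + 8) \<le> M * y * (M + 8)" using M21 by (intro mult_right_mono) auto
        then show ?thesis by simp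
      qed
      finally show ?thesis using M21 by simp
    qed
    moreover have "y * M \<le> (M + 3) * x" using Ma by (simp add: a_def algebra_simps)
    moreover have "(M + 3) * x \<le> (M + 3) * y" using o M21 by simp
    moreover have "M + 3 \<le> 4 * y" using M y by simp
    ultimately show False
      using three_not_clear_at_ratio[OF no, of y "M + 3" k k "Suc k"] M o y
      unfolding p by (auto simp: algebra_simps)
  qed
  have cM: "3 * x < c * M" "c * M < 5 * x" using A by (simp_all add: c_def algebra_simps)
  have c_small: "5 * c \<le> 3 * x"
  proof -
    have "c * (M + 3) < a * (M + 3) + 2 * y" using B by (simp add: c_def a_def algebra_simps)
    also have "\<dots> \<le> (a + 2) * (M + 3)" using M by (simp add: algebra_simps)
    finally have "c < a + 2" using M21 by simp
    then show ?thesis using a_small y by (simp add: x_eq)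
  qed
  have c0: "0 < c" using cM o M21 by (smt (verit) mult_nonpos_nonneg)
  obtain i :: nat where i: "5 * x \<le> (M + 5 * real i) * c" "(M + 5 * real i) * c < 5 * x + 5 * c"
  proof -
    have "0 \<le> 5 * x / c - M" using cM c0 by (simp add: field_simps)
    then obtain i :: nat where "5 * x / c - M \<le> 5 * real i" "5 * real i < 5 * x / c - M + 5"
      by (rule next_multiple) auto
    then show thesis using that[of i] c0 by (simp add: field_simps)
  qed
  define N where "N = M + 5 * real i"
  have "3 * N \<le> 5 * M + 15"
  proof -
    have "x * (3 * (N - 5)) = 3 * x * (N - 5)" by simp
    also have "\<dots> \<le> c * M * (N - 5)" using M21 cM by (intro mult_right_mono) (auto simp: N_def)
    also have "\<dots> = M * ((N - 5) * c)" by simp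
    also have "\<dots> \<le> M * (5 * x)" using i M21 by (intro mult_left_mono) (auto simp: N_def algebra_simps)
    also have "M * (5 * x) = x * (5 * M)" by simp
    finally show ?thesis using o by simp
  qed
  have Na: "N * a \<le> 3 * x"
  proof -
    have "3 * N * a \<le> (5 * M + 15) * a" using \<open>3 * N \<le> 5 * M + 15\<close> a0 by (intro mult_right_mono) auto
    also have "\<dots> \<le> 9 * x" using a9 unfolding x_eq by (simp add: algebra_simps)
    finally show ?thesis by simp
  qed
  have N_pos: "x \<le> N" "0 \<le> N * a" using \<open>x < M\<close> a0 M21 by (simp_all add: N_def)
  have N_le: "N \<le> 4 * x" using \<open>3 * N \<le> 5 * M + 15\<close> M y a_small unfolding x_eq by argo
  have Ny: "N * y = N * x + N * a" and Nz: "N * z = N * x + N * c"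
    by (simp_all add: a_def c_def algebra_simps)
  have Nc: "N * c \<le> 8 * x" "5 * x \<le> N * c" using i c_small by (simp_all add: N_def)
  have e: "5 * real (k + i) + 1 = N" "5 * real (k + i) + 4 = N + 3"
    "5 * real (Suc (k + i)) + 1 = N + 5" "5 * real (Suc (k + i)) + 4 = N + 8"
    by (simp_all add: N_def M_def)
  have "0 < x \<and> x \<le> N \<and> N \<le> 4 * x \<and> N * x \<le> N * x \<and> N * x \<le> (N + 3) * x
    \<and> N * x \<le> N * y \<and> N * y \<le> (N + 3) * x \<and> (N + 5) * x \<le> N * z \<and> N * z \<le> (N + 8) * x"
    unfolding Ny Nz distrib_right using o N_pos N_le Na Nc by (intro conjI) simp_all
  then show False
    using three_not_clear_at_ratio[OF no, of x N "k + i" "k + i" "Suc (k + i)"] unfolding e by blast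
qed

section \<open>Three speeds: the bounded part\<close>

text \<open>
  For fast \<open>z\<close>: an interval starting at \<open>N / v\<close> of length \<open>h \<ge> 2 / z\<close> on which \<open>x\<close> and \<open>y\<close> are
  clear. Over the time \<open>h\<close> their phases move by at most \<open>h g\<close>; this crude bound replaces the products
  \<open>h x v\<close> and \<open>h y v\<close> and keeps the inequalities linear when \<open>h\<close>, \<open>g\<close> and \<open>N\<close> are numerals.
\<close>

lemma three_not_clear_after_ratio:
  fixes x y z v N h g :: real and p q :: nat
  assumes o: "1 \<le> x" "x \<le> y" "y \<le> z" and no: "\<not> jointly_clear 5 {x, y, z}"
    and h: "y \<le> g" "2 \<le> h * z"
  shows "\<not> (0 < v \<and> v \<le> N \<and> N + h * v \<le> 4 * v
    \<and> (5 * real p + 1) * v \<le> N * x \<and> N * x + h * g * v \<le> (5 * real p + 4) * v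
    \<and> (5 * real q + 1) * v \<le> N * y \<and> N * y + h * g * v \<le> (5 * real q + 4) * v)"
proof
  assume *: "0 < v \<and> v \<le> N \<and> N + h * v \<le> 4 * v
    \<and> (5 * real p + 1) * v \<le> N * x \<and> N * x + h * g * v \<le> (5 * real p + 4) * v
    \<and> (5 * real q + 1) * v \<le> N * y \<and> N * y + h * g * v \<le> (5 * real q + 4) * v"
  then have v: "0 < v" by simp
  have "0 < h" using h(2) o by (smt (verit) mult_nonpos_nonneg)
  then have hg: "h * x \<le> h * g" "h * y \<le> h * g" using o h by simp_all
  have "N / v * x \<le> 5 * real p + 4 - h * g" "N / v * y \<le> 5 * real q + 4 - h * g"
    using * by (simp_all add: pos_divide_le_eq left_diff_distrib)
  then have "(N / v + h) * x \<le> 5 * real p + 4" "(N / v + h) * y \<le> 5 * real q + 4"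
    using hg unfolding distrib_right by linarith+
  moreover have "5 * real p + 1 \<le> N / v * x" "5 * real q + 1 \<le> N / v * y"
    using * by (simp_all add: pos_le_divide_eq)
  moreover have "1 \<le> N / v" "N / v + h \<le> 4" using * by (simp_all add: field_simps)
  moreover have "2 \<le> z * (N / v + h - N / v)" using h by (simp add: mult.commute)
  ultimately have "jointly_clear 5 {x, y, z}" by (intro three_by_interval[OF o])
  then show False using no by blast
qed

text \<open>
  Each entry \<open>v N p q r\<close> below is a moment \<open>N / v\<close> together with the laps of \<open>x, y, z\<close> at
  that moment; it is good on a polyhedron in \<open>(x, y, z)\<close>, and the polyhedra of the list cover the whole
  region. Moments depending on the speeds cannot be avoided: if \<open>x = 3/2\<close>, \<open>z\<close> is slightly
  larger than \<open>4\<close> and \<open>y = 2 z / 3\<close>, the only good moments are \<open>6 / z\<close> and \<open>9 / z\<close>.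
\<close>

lemma three_if_y_le_7:
  fixes x y z :: real
  assumes o: "1 \<le> x" "x \<le> y" "y \<le> z" and y: "y \<le> 7"
  shows "jointly_clear 5 {x, y, z}"
proof (rule ccontr)
  assume no: "\<not> jointly_clear 5 {x, y, z}"
  note miss = three_not_clear_at_ratio[OF no]
  have "z \<le> 16"
  proof (rule ccontr)
    assume "\<not> z \<le> 16"
    then have "2 \<le> 1 / 8 * z" by simp
    note late = three_not_clear_after_ratio[OF o no y this]
    show False
      using o y
        late[of 1 1 0 0] late[of 1 1 0 1] late[of 1 1 1 1] late[of x 6 1 1] late[of y 6 0 1]
        late[of y 11 1 2] late[of y 12 1 2] late[of y 16 1 3]
      by (simp; argo)
  qed
  then show False
    using o y
      miss[of 1 1 0 0 1] miss[of x 4 0 1 1] miss[of y 9 1 1 2] miss[of y 9 1 1 4] miss[of y 11 1 2 2]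
      miss[of y 11 1 2 7] miss[of z 4 0 0 0] miss[of z 6 0 0 1] miss[of z 9 0 1 1] miss[of z 9 1 1 1]
      miss[of z 11 0 0 2] miss[of z 11 0 1 2] miss[of z 13 0 1 2] miss[of z 14 1 1 2]
      miss[of z 16 0 0 3] miss[of z 16 0 1 3] miss[of z 16 1 1 3] miss[of z 16 1 2 3]
      miss[of z 18 1 2 3] miss[of z 19 1 1 3] miss[of z 21 1 2 4] miss[of z 24 0 1 4]
      miss[of z 24 1 1 4] miss[of z 24 1 2 4] miss[of z 26 1 2 5] miss[of z 29 1 1 5]
      miss[of z 31 1 1 6] miss[of z 31 1 2 6] miss[of z 36 1 2 7] miss[of z 44 1 2 8]
    by (simp; argo)
qed

text \<open>
  The two lower pieces of the strip belong to \<open>k = 2\<close> and \<open>k = 3\<close>. The upper bound on \<open>y - x\<close>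
  is the only nonlinear one; replacing \<open>y\<close> by its smallest value makes it linear, and the same
  method as for \<open>y \<le> 7\<close> applies.
\<close>

lemma three_in_strip_7_12:
  fixes x y z :: real
  assumes o: "1 \<le> x" "x \<le> y" "y \<le> z" and y: "7 < y" "y \<le> 12" and low: "12 * x < 11 * y"
    and high: "(y - x) * (2 * y - 3) < 2 * y"
  shows "jointly_clear 5 {x, y, z}"
proof (rule ccontr)
  assume no: "\<not> jointly_clear 5 {x, y, z}"
  note miss = three_not_clear_at_ratio[OF no]
  have high': "11 * (y - x) \<le> 14"
  proof (rule ccontr)
    assume "\<not> 11 * (y - x) \<le> 14"
    then have "14 / 11 * (2 * y - 3) \<le> (y - x) * (2 * y - 3)" using y by (intro mult_right_mono) auto
    also note high
    finally show False using y by simp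
  qed
  have "z \<le> 20"
  proof (rule ccontr)
    assume "\<not> z \<le> 20"
    then have "2 \<le> 1 / 10 * z" by simp
    note late = three_not_clear_after_ratio[OF o no y(2) this]
    show False
      using o y low high'
        late[of x 11 2 2] late[of y 26 4 5]
      by (simp; argo)
  qed
  then show False
    using o y low high'
      miss[of x 11 2 2 2] miss[of x 11 2 2 3] miss[of x 11 2 2 4] miss[of y 14 2 2 3]
      miss[of y 14 2 2 5] miss[of y 16 2 3 4] miss[of y 21 3 4 4] miss[of y 21 3 4 7]
      miss[of z 21 1 1 4] miss[of z 21 2 2 4] miss[of z 29 2 2 5] miss[of z 49 3 4 9]
    by (simp; argo)
qed

lemma three_in_strip_12_17:
  fixes x y z :: real
  assumes o: "1 \<le> x" "x \<le> y" "y \<le> z" and y: "12 < y" "y \<le> 17" and low: "17 * x < 16 * y"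
    and high: "(y - x) * (2 * y - 3) < 2 * y"
  shows "jointly_clear 5 {x, y, z}"
proof (rule ccontr)
  assume no: "\<not> jointly_clear 5 {x, y, z}"
  note miss = three_not_clear_at_ratio[OF no]
  have high': "7 * (y - x) \<le> 8"
  proof (rule ccontr)
    assume "\<not> 7 * (y - x) \<le> 8"
    then have "8 / 7 * (2 * y - 3) \<le> (y - x) * (2 * y - 3)" using y by (intro mult_right_mono) auto
    also note high
    finally show False using y by simp
  qed
  have "z \<le> 25"
  proof (rule ccontr)
    assume "\<not> z \<le> 25"
    then have "2 \<le> 2 / 25 * z" by simp
    note late = three_not_clear_after_ratio[OF o no y(2) this]
    show False
      using o y low high'
        late[of x 16 3 3] late[of x 42 8 9]
      by (simp; argo)
  qed
  then show False
    using o y low high'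
      miss[of x 16 3 3 3] miss[of y 18 3 3 4] miss[of y 19 3 3 5] miss[of y 19 3 3 6]
      miss[of y 24 4 4 6] miss[of y 29 5 5 6] miss[of z 26 2 2 5] miss[of z 29 3 3 5]
      miss[of z 34 3 3 6]
    by (simp; argo)
qed

lemma jointly_clear_three_sorted:
  fixes x y z :: real
  assumes o: "1 \<le> x" "x \<le> y" "y \<le> z"
  shows "jointly_clear 5 {x, y, z}"
proof (cases "y \<le> 7")
  case True
  then show ?thesis using three_if_y_le_7[OF o] by blast
next
  case False
  show ?thesis
  proof (rule ccontr)
    assume no: "\<not> jointly_clear 5 {x, y, z}"
    obtain k :: nat where k: "5 * real k - 3 < y" "y \<le> 5 * real k + 2"
      and low: "(5 * real k + 2) * x < (5 * real k + 1) * y"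
      and high: "(y - x) * (2 * y - 3) < 2 * y"
      by (rule three_not_clear_imp_strip[OF o _ no]) (use False in auto)
    consider "17 < y" | "k = 2" "y \<le> 12" | "k = 3" "12 < y" "y \<le> 17"
    proof (cases "17 < y")
      case le: False
      then have "1 < k" "k < 4" using k False by linarith+
      then have "k = 2 \<or> k = 3" by auto
      then show thesis using that k le by auto
    qed
    then show False
    proof cases
      case 1 then show False using three_in_strip_above_17[OF o _ k low high] no by blast
    next
      case 2 then show False using three_in_strip_7_12[OF o _ _ _ high] low no False by simp
    next
      case 3 then show False using three_in_strip_12_17[OF o _ _ _ high] low no by simp
    qed
  qed
qed

lemma jointly_clear_three:
  fixes x y z :: real
  assumes "1 \<le> x" "1 \<le> y" "1 \<le> z"
  shows "jointly_clear 5 {x, y, z}"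
proof -
  consider "x \<le> y" "y \<le> z" | "x \<le> z" "z \<le> y" | "y \<le> x" "x \<le> z" | "y \<le> z" "z \<le> x"
    | "z \<le> x" "x \<le> y" | "z \<le> y" "y \<le> x" by linarith
  then show ?thesis
    using assms
      jointly_clear_three_sorted[of x y z] jointly_clear_three_sorted[of x z y]
      jointly_clear_three_sorted[of y x z] jointly_clear_three_sorted[of y z x]
      jointly_clear_three_sorted[of z x y] jointly_clear_three_sorted[of z y x]
    by cases (simp_all add: insert_commute)
qed

theorem theorem1:
  "Nmin 1 = 1 \<and> Nmin 2 = 1 \<and> Nmin 3 = 1"
proof (intro conjI)
  show "Nmin 1 = 1"
  proof (rule Nmin_eq_1)
    fix x :: "nat \<Rightarrow> real" assume "\<And>i. i < 1 \<Longrightarrow> 1 \<le> x i"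
    then have "jointly_clear 3 {x 0}" by (intro jointly_clear_one) auto
    then show "jointly_clear (1 + 2) (x ` {..<1})" by (simp add: lessThan_Suc numeral_3_eq_3)
  qed
  show "Nmin 2 = 1"
  proof (rule Nmin_eq_1)
    fix x :: "nat \<Rightarrow> real" assume "\<And>i. i < 2 \<Longrightarrow> 1 \<le> x i"
    then have "1 \<le> x 0" "1 \<le> x 1" by auto
    then have "jointly_clear 4 {x 0, x 1}"
      using jointly_clear_two[of "x 0" "x 1"] jointly_clear_two[of "x 1" "x 0"]
      by (cases "x 0 \<le> x 1") (simp_all add: insert_commute)
    moreover have "x ` {..<2} = {x 0, x 1}" by (auto simp: lessThan_Suc numeral_2_eq_2)
    ultimately show "jointly_clear (2 + 2) (x ` {..<2})" by simp
  qed
  show "Nmin 3 = 1"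
  proof (rule Nmin_eq_1)
    fix x :: "nat \<Rightarrow> real" assume "\<And>i. i < 3 \<Longrightarrow> 1 \<le> x i"
    then have "jointly_clear 5 {x 0, x 1, x 2}" by (intro jointly_clear_three) auto
    moreover have "x ` {..<3} = {x 0, x 1, x 2}" by (auto simp: lessThan_Suc numeral_3_eq_3 numeral_2_eq_2)
    ultimately show "jointly_clear (3 + 2) (x ` {..<3})" by simp
  qed
qed

end
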